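(* A function $f\in\mathcal{A}$ belongs to the class $\mathcal{C}_{Ne}$ if, and only if, there exists an analytic function $q$ on $\mathbb{D}$ satisfying $q(z)\prec\varphi_{Ne}(z)=1+z-z^3/3$ such that $$f(z)=\int_{0}^{z}\exp\left(\int_0^\zeta\frac{q(\eta)-1}{\eta}\,d\eta\right)d\zeta,\quad z\in\mathbb{D}.$$
   Context: $\mathbb{D}$ is the open unit disk. $\mathcal{A}$ is the set of analytic functions $f$ on $\mathbb{D}$ with $f(0)=0$ and $f'(0)=1$. For analytic $f,g$ on $\mathbb{D}$, $f\prec g$ means there is an analytic $w$ on $\mathbb{D}$ with $w(0)=0$ and $|w(z)|<1$ such that $f(z)=g(w(z))$ for all $z\in\mathbb{D}$. $\varphi_{Ne}(z)=1+z-z^3/3$, and $\mathcal{C}_{Ne}=\{f\in\mathcal{A}: 1+zf''(z)/f'(z)\prec\varphi_{Ne}(z)\}$ (the function $1+zf''/f'$ being analytic on $\mathbb{D}$). *)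

theory Defs
  imports "HOL-Complex_Analysis.Complex_Analysis"
begin

abbreviation unit_disk :: "complex set" where
  "unit_disk \<equiv> ball 0 1"

text \<open>Functions on the disk are total functions on \<^typ>\<open>complex\<close>; their values outside the
  disk are irrelevant. On an open set, \<^const>\<open>holomorphic_on\<close> coincides with
  \<^const>\<open>analytic_on\<close>.\<close>

definition class_A :: "(complex \<Rightarrow> complex) set" where
  "class_A = {f. f holomorphic_on unit_disk \<and> f 0 = 0 \<and> deriv f 0 = 1}"

definition subordinate :: "(complex \<Rightarrow> complex) \<Rightarrow> (complex \<Rightarrow> complex) \<Rightarrow> bool"
    (infix "\<prec>\<^sub>s" 50) where
  "f \<prec>\<^sub>s g \<longleftrightarrow> f holomorphic_on unit_disk \<and> g holomorphic_on unit_disk \<and>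
     (\<exists>w. w holomorphic_on unit_disk \<and> w 0 = 0 \<and> (\<forall>z\<in>unit_disk. norm (w z) < 1) \<and>
          (\<forall>z\<in>unit_disk. f z = g (w z)))"

definition phi_Ne :: "complex \<Rightarrow> complex" where
  "phi_Ne z = 1 + z - z ^ 3 / 3"

text \<open>Subordination includes holomorphy of \<open>1 + z f''(z) / f'(z)\<close> on the whole disk. This forces
  \<open>f'\<close> to have no zero there, despite the convention \<open>x / 0 = 0\<close>: since \<open>f'\<close> is not identically
  zero and \<open>f'(0) = 1\<close>, the quotient is unbounded near any zero of \<open>f'\<close>.\<close>

definition class_C_Ne :: "(complex \<Rightarrow> complex) set" where
  "class_C_Ne =
     {f \<in> class_A. (\<lambda>z. 1 + z * deriv (deriv f) z / deriv f z) \<prec>\<^sub>s phi_Ne}"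

end

theory Submission
  imports Defs
begin

text \<open>Put \<open>p(z) = (q(z) - 1) / z\<close>, which extends holomorphically to the disk since \<open>q(0) = 1\<close>, and let
  \<open>P\<close> be its primitive with \<open>P(0) = 0\<close>. Both sides of the equivalence say that \<open>f' = exp P\<close> for some
  such \<open>q\<close>, namely \<open>q = 1 + z f'' / f'\<close>: the relation \<open>z f'' = (q - 1) f'\<close> is the linear
  equation \<open>f'' = p f'\<close>, whose solution with \<open>f'(0) = 1\<close> is \<open>exp P\<close>.\<close>

text \<open>Convexity keeps the segment inside \<open>S\<close>, so the fundamental theorem of
  calculus applies. Both the inner and the outer integral of the theorem are evaluated this
  way.\<close>

lemma contour_integral_linepath_primitive:
  assumes "convex S" "a \<in> S" "z \<in> S"
    and "\<And>w. w \<in> S \<Longrightarrow> (F has_field_derivative f w) (at w)"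
  shows "contour_integral (linepath a z) f = F z - F a"
proof -
  have "(f has_contour_integral F (pathfinish (linepath a z)) - F (pathstart (linepath a z)))
          (linepath a z)"
    using assms
    by (intro contour_integral_primitive[where S = S])
       (auto intro: has_field_derivative_at_within simp: closed_segment_subset)
  thus ?thesis
    by (simp add: contour_integral_unique)
qed

text \<open>Since \<open>d\<close> does not vanish identically, its zeros are isolated;
  \<open>g - h\<close> is then zero on a punctured neighbourhood of each of them, and continuity
  fills in the centre. This permits cancelling a factor or clearing a denominator \<open>d\<close>
  that may have zeros.\<close>

lemma holomorphic_eq_off_zeros_imp_eq:
  assumes S: "open S" "connected S"
    and hol: "g holomorphic_on S" "h holomorphic_on S" "d holomorphic_on S"
    and nontriv: "b \<in> S" "d b \<noteq> 0"
    and eq: "\<And>z. z \<in> S \<Longrightarrow> d z \<noteq> 0 \<Longrightarrow> g z = h z"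
    and z: "z \<in> S"
  shows "g z = h z"
proof (cases "d z = 0")
  case True
  obtain r where r: "0 < r" "ball z r \<subseteq> S" "\<And>w. w \<in> ball z r - {z} \<Longrightarrow> d w \<noteq> 0"
    using isolated_zeros[OF hol(3) S z True nontriv] by blast
  have "isCont (\<lambda>w. g w - h w) z"
    using hol(1,2) S(1) z
    by (intro continuous_intros)
       (auto dest!: holomorphic_on_imp_continuous_on simp: continuous_on_eq_continuous_at)
  hence lim: "((\<lambda>w. g w - h w) \<longlongrightarrow> g z - h z) (at z)"
    by (simp add: isCont_def)
  have "eventually (\<lambda>w. w \<in> ball z r - {z}) (at z)"
    using r(1) by (intro eventually_at_in_open) auto
  hence "eventually (\<lambda>w. g w - h w = 0) (at z)"
    by eventually_elim (use r eq in auto)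
  hence "((\<lambda>w. g w - h w) \<longlongrightarrow> 0) (at z)"
    by (rule tendsto_eventually)
  with lim have "g z - h z = 0"
    by (intro tendsto_unique[OF _ lim]) auto
  thus ?thesis by simp
qed (use eq z in auto)

text \<open>Integrating factor: \<open>u * exp (- P)\<close> has derivative zero, hence is constant
  on \<open>S\<close>, and \<open>init\<close> makes the constant 1.\<close>

lemma linear_ode_unique:
  fixes u P p :: "complex \<Rightarrow> complex"
  assumes "convex S" "a \<in> S" "z \<in> S"
    and P: "\<And>w. w \<in> S \<Longrightarrow> (P has_field_derivative p w) (at w)"
    and u: "\<And>w. w \<in> S \<Longrightarrow> (u has_field_derivative p w * u w) (at w)"
    and init: "u a = exp (P a)"
  shows "u z = exp (P z)"
proof -
  have "((\<lambda>w. u w * exp (- P w)) has_field_derivative 0) (at w within S)" if "w \<in> S" for w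
    by (rule derivative_eq_intros P[OF that, THEN has_field_derivative_at_within]
          u[OF that, THEN has_field_derivative_at_within] refl)+ simp
  from has_field_derivative_zero_constant[OF \<open>convex S\<close> this]
  obtain c where c: "\<And>w. w \<in> S \<Longrightarrow> u w * exp (- P w) = c" by blast
  have "c = 1"
    using c[OF \<open>a \<in> S\<close>] init by (simp add: exp_minus)
  with c[OF \<open>z \<in> S\<close>] show ?thesis
    by (simp add: exp_minus field_simps)
qed

lemma primitive_of_difference_quotient:
  assumes S: "convex S" "open S" "0 \<in> S"
    and q: "q holomorphic_on S" "q 0 = 1"
  obtains P p where "p holomorphic_on S" "P 0 = 0"
    "\<And>z. z \<in> S \<Longrightarrow> (P has_field_derivative p z) (at z)"
    "\<And>z. z \<in> S \<Longrightarrow> z * p z = q z - 1"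
    "\<And>z. z \<in> S \<Longrightarrow> contour_integral (linepath 0 z) (\<lambda>\<eta>. (q \<eta> - 1) / \<eta>) = P z"
proof -
  \<comment> \<open>The singularity at 0 is removable; \<open>deriv q 0\<close> is the value that
    fills it.\<close>
  define p where "p = (\<lambda>z. if z = 0 then deriv q 0 else (q z - q 0) / (z - 0))"
  have p: "p holomorphic_on S"
    unfolding p_def using q(1) S(2) by (rule pole_lemma_open)
  obtain P0 where P0: "\<And>z. z \<in> S \<Longrightarrow> (P0 has_field_derivative p z) (at z within S)"
    by (rule holomorphic_convex_primitive'[OF S(1,2) p]) blast
  define P where "P = (\<lambda>z. P0 z - P0 0)"
  have P: "(P has_field_derivative p z) (at z)" if "z \<in> S" for z
    using DERIV_diff[OF P0[OF that] DERIV_const[of "P0 0"]]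
    unfolding P_def at_within_open[OF that S(2)] by simp
  have P_0: "P 0 = 0" by (simp add: P_def)
  have int: "contour_integral (linepath 0 z) (\<lambda>\<eta>. (q \<eta> - 1) / \<eta>) = P z" if z: "z \<in> S" for z
  proof (cases "z = 0")
    case False
    \<comment> \<open>The integrands differ at most at the endpoint 0, where the left one takes the
      default value 0. A single point does not affect the integral along a simple path, and the
      segment is simple because \<open>z\<close> is nonzero.\<close>
    have "contour_integral (linepath 0 z) (\<lambda>\<eta>. (q \<eta> - 1) / \<eta>) = contour_integral (linepath 0 z) p"
      using False
      by (intro contour_integral_spike_finite_simple_path[where A = "{0}"])
         (auto simp: p_def q(2) intro: simple_path_linepath)
    also have "\<dots> = P z"
      using contour_integral_linepath_primitive[OF S(1,3) z P] P_0 by simp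
    finally show ?thesis .
  qed (simp add: P_0)
  have "z * p z = q z - 1" for z
    by (simp add: p_def q(2))
  from that[OF p P_0 P this int] show ?thesis .
qed

lemma subordinate_at_0:
  assumes "f \<prec>\<^sub>s g"
  shows "f 0 = g 0"
  using assms unfolding subordinate_def by force

lemma subordinate_cong:
  assumes "\<And>z. z \<in> unit_disk \<Longrightarrow> f z = f' z"
  shows "f \<prec>\<^sub>s g \<longleftrightarrow> f' \<prec>\<^sub>s g"
  using assms holomorphic_cong[OF refl, of unit_disk f f'] unfolding subordinate_def by auto

theorem corollary2p1:
  fixes f :: "complex \<Rightarrow> complex"
  assumes "f \<in> class_A"
  shows "f \<in> class_C_Ne \<longleftrightarrow>
    (\<exists>q. q holomorphic_on unit_disk \<and> q \<prec>\<^sub>s phi_Ne \<and>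
       (\<forall>z\<in>unit_disk. f z =
          contour_integral (linepath 0 z)
            (\<lambda>\<zeta>. exp (contour_integral (linepath 0 \<zeta>) (\<lambda>\<eta>. (q \<eta> - 1) / \<eta>)))))"
    (is "_ \<longleftrightarrow> (\<exists>q. _ \<and> _ \<and> (\<forall>z\<in>_. f z = ?I q z))")
proof -
  have f: "f holomorphic_on unit_disk" "f 0 = 0" "deriv f 0 = 1"
    using assms by (auto simp: class_A_def)
  have f': "(f has_field_derivative deriv f z) (at z)" if "z \<in> unit_disk" for z
    using f(1) that by (intro holomorphic_derivI) auto
  have hol': "deriv f holomorphic_on unit_disk" "deriv (deriv f) holomorphic_on unit_disk"
    using f(1) by (auto intro!: holomorphic_deriv)
  have f'': "(deriv f has_field_derivative deriv (deriv f) z) (at z)" if "z \<in> unit_disk" for z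
    using hol'(1) that by (intro holomorphic_derivI) auto
  define Q where "Q = (\<lambda>z. 1 + z * deriv (deriv f) z / deriv f z)"
  have disk: "convex unit_disk" "open unit_disk" "connected unit_disk" "0 \<in> unit_disk"
    by auto
  have integral_eq: "?I q z = contour_integral (linepath 0 z) (\<lambda>\<zeta>. exp (P \<zeta>))"
    if P: "\<And>w. w \<in> unit_disk \<Longrightarrow>
             contour_integral (linepath 0 w) (\<lambda>\<eta>. (q \<eta> - 1) / \<eta>) = P w"
      and z: "z \<in> unit_disk" for q P z
  proof (rule contour_integral_eq)
    have "path_image (linepath 0 z) \<subseteq> unit_disk"
      unfolding path_image_linepath by (rule closed_segment_subset[OF disk(4) z disk(1)])
    thus "exp (contour_integral (linepath 0 \<zeta>) (\<lambda>\<eta>. (q \<eta> - 1) / \<eta>)) = exp (P \<zeta>)"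
      if "\<zeta> \<in> path_image (linepath 0 z)" for \<zeta>
      using P[of \<zeta>] that by auto
  qed
  have fwd: "(\<exists>q. q holomorphic_on unit_disk \<and> q \<prec>\<^sub>s phi_Ne \<and> (\<forall>z\<in>unit_disk. f z = ?I q z))"
    if "Q \<prec>\<^sub>s phi_Ne"
  proof (intro exI conjI ballI)
    \<comment> \<open>The witness for \<open>q\<close> is \<open>Q\<close> itself.\<close>
    show Q: "Q holomorphic_on unit_disk"
      using that by (simp add: subordinate_def)
    have Q_0: "Q 0 = 1" by (simp add: Q_def)
    obtain P p where p: "p holomorphic_on unit_disk" and P_0: "P 0 = 0"
      and P: "\<And>z. z \<in> unit_disk \<Longrightarrow> (P has_field_derivative p z) (at z)"
      and zp: "\<And>z. z \<in> unit_disk \<Longrightarrow> z * p z = Q z - 1"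
      and int: "\<And>z. z \<in> unit_disk \<Longrightarrow>
                  contour_integral (linepath 0 z) (\<lambda>\<eta>. (Q \<eta> - 1) / \<eta>) = P z"
      by (rule primitive_of_difference_quotient[OF disk(1,2,4) Q Q_0]) blast
    \<comment> \<open>Away from the zeros of \<open>deriv f\<close> this is the definition of
      \<open>Q\<close> with the denominator cleared. At a zero the convention
      \<open>x / 0 = 0\<close> would make \<open>Q\<close> equal to 1 and say nothing about
      \<open>deriv (deriv f)\<close>, so the identity is extended by continuity.\<close>
    have *: "z * deriv (deriv f) z = z * p z * deriv f z" if "z \<in> unit_disk" for z
      by (rule holomorphic_eq_off_zeros_imp_eq[where d = "deriv f" and b = 0 and S = unit_disk])
         (use that f zp p hol' in \<open>auto intro!: holomorphic_intros simp: Q_def\<close>)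
    \<comment> \<open>The factor \<open>z\<close> is cancelled in the same way; \<open>1/2\<close>
      is just some point of the disk where it is nonzero.\<close>
    have ode: "deriv (deriv f) z = p z * deriv f z" if "z \<in> unit_disk" for z
      by (rule holomorphic_eq_off_zeros_imp_eq[where d = "\<lambda>z. z" and b = "1/2" and S = unit_disk])
         (use that * p hol' in \<open>auto intro!: holomorphic_intros\<close>)
    \<comment> \<open>Only here does it emerge that \<open>deriv f\<close> has no zero in the
      disk.\<close>
    have u: "deriv f z = exp (P z)" if "z \<in> unit_disk" for z
      by (rule linear_ode_unique[OF disk(1,4) that P]) (use f'' ode P_0 f(3) in auto)
    have F: "(f has_field_derivative exp (P z)) (at z)" if "z \<in> unit_disk" for z
      using f'[OF that] unfolding u[OF that] .
    show "f z = ?I Q z" if z: "z \<in> unit_disk" for z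
      using contour_integral_linepath_primitive[OF disk(1,4) z F] integral_eq[OF int z] f(2) by simp
  qed fact
  have bwd: "Q \<prec>\<^sub>s phi_Ne"
    if q: "q holomorphic_on unit_disk" "q \<prec>\<^sub>s phi_Ne" and f_eq: "\<forall>z\<in>unit_disk. f z = ?I q z" for q
  proof -
    have q_0: "q 0 = 1"
      using subordinate_at_0[OF q(2)] by (simp add: phi_Ne_def)
    obtain P p where P: "\<And>z. z \<in> unit_disk \<Longrightarrow> (P has_field_derivative p z) (at z)"
      and zp: "\<And>z. z \<in> unit_disk \<Longrightarrow> z * p z = q z - 1"
      and int: "\<And>z. z \<in> unit_disk \<Longrightarrow>
                  contour_integral (linepath 0 z) (\<lambda>\<eta>. (q \<eta> - 1) / \<eta>) = P z"
      by (rule primitive_of_difference_quotient[OF disk(1,2,4) q(1) q_0]) blast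
    have "P holomorphic_on unit_disk"
      unfolding holomorphic_on_open[OF disk(2)] using P by blast
    hence "(\<lambda>z. exp (P z)) holomorphic_on unit_disk"
      by (intro holomorphic_intros)
    then obtain F where F':
      "\<And>z. z \<in> unit_disk \<Longrightarrow> (F has_field_derivative exp (P z)) (at z within unit_disk)"
      by (rule holomorphic_convex_primitive'[OF disk(1,2)]) blast
    have F: "(F has_field_derivative exp (P z)) (at z)" if "z \<in> unit_disk" for z
      using F'[OF that] unfolding at_within_open[OF that disk(2)] .
    \<comment> \<open>The outer integral is evaluated by a primitive \<open>F\<close> of
      \<open>exp P\<close>, so \<open>f\<close> can be differentiated through
      \<open>F\<close>.\<close>
    have f_F: "f z = F z - F 0" if "z \<in> unit_disk" for z
      using bspec[OF f_eq that] integral_eq[OF int that]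
        contour_integral_linepath_primitive[OF disk(1,4) that F] by (simp only:)
    have d1: "deriv f z = exp (P z)" if "z \<in> unit_disk" for z
    proof -
      have "((\<lambda>z. F z - F 0) has_field_derivative exp (P z)) (at z)"
        using F[OF that] by (auto intro!: derivative_eq_intros)
      \<comment> \<open>The formula for \<open>f\<close> is known on the disk only; openness of the
        disk suffices to transfer the derivative.\<close>
      hence "(f has_field_derivative exp (P z)) (at z)"
        by (rule has_field_derivative_transform_within_open[OF _ disk(2) that]) (simp add: f_F)
      thus ?thesis by (rule DERIV_imp_deriv)
    qed
    have d2: "deriv (deriv f) z = exp (P z) * p z" if "z \<in> unit_disk" for z
    proof -
      have "((\<lambda>z. exp (P z)) has_field_derivative exp (P z) * p z) (at z)"
        using P[OF that] by (auto intro!: derivative_eq_intros)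
      hence "(deriv f has_field_derivative exp (P z) * p z) (at z)"
        by (rule has_field_derivative_transform_within_open[OF _ disk(2) that]) (simp add: d1)
      thus ?thesis by (rule DERIV_imp_deriv)
    qed
    \<comment> \<open>The denominator \<open>exp (P z)\<close> never vanishes, so the quotient is
      genuinely \<open>p z\<close>. Agreement on the disk is enough, as subordination ignores values
      outside it.\<close>
    have "Q z = q z" if "z \<in> unit_disk" for z
      using zp[OF that] by (simp add: Q_def d1[OF that] d2[OF that])
    from subordinate_cong[OF this] q(2) show ?thesis by simp
  qed
  have C_iff: "f \<in> class_C_Ne \<longleftrightarrow> Q \<prec>\<^sub>s phi_Ne"
    using assms by (simp add: class_C_Ne_def Q_def)
  show ?thesis
    unfolding C_iff by (rule iffI, erule fwd, elim exE conjE, erule (2) bwd)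
qed

end
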